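(* Suppose $r_n=o\big((n\log n)^{-1/3}\big)$. Then for every $\varepsilon>0$, $$\mathbb{P}\big(\mathscr C_1(\Gamma_n(r_n,1))\ge \varepsilon n\big)\longrightarrow 0\quad (n\to\infty).$$
   Context: The unit square $[0,1]^2$ is viewed as a torus with distance $d(x,y)=\big(\sum_{i=1}^2\min(|x_i-y_i|,1-|x_i-y_i|)^2\big)^{1/2}$, and $B(x,r)=\{y: d(x,y)<r\}$. Let $\mathbf X=\{X_1,\dots,X_n\}$ be independent uniform points in $[0,1]^2$, and $r_n>0$. $\Gamma_n(r_n,1)$ is the following random graph on $[n]=\{1,\dots,n\}$: independently for each $u$ (and independently of everything else given $\mathbf X$), a point $Y(X_u)$ is chosen uniformly at random from $\mathbf X\cap B(X_u,r_n)$; the digraph $\Gamma_n^+$ has an oriented edge $(u,v)$, $u\ne v$, iff $X_v=Y(X_u)$ (self-selection creates no edge), and $\Gamma_n(r_n,1)$ is the undirected graph with edge $\{u,v\}$ iff $(u,v)$ or $(v,u)$ is in $\Gamma_n^+$. $\mathscr C_1(G)$ denotes the number of vertices of the largest connected component of a graph $G$. *)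

theory Defs
  imports "HOL-Probability.Probability" "HOL-Library.Landau_Symbols"
begin

definition tdist :: "real \<times> real \<Rightarrow> real \<times> real \<Rightarrow> real" where
  "tdist x y = sqrt ((min \<bar>fst x - fst y\<bar> (1 - \<bar>fst x - fst y\<bar>))\<^sup>2
                   + (min \<bar>snd x - snd y\<bar> (1 - \<bar>snd x - snd y\<bar>))\<^sup>2)"

text \<open>Indices v < n with X v in the open torus ball B(X u, r) (contains u itself).\<close>
definition nbhd :: "nat \<Rightarrow> real \<Rightarrow> (nat \<Rightarrow> real \<times> real) \<Rightarrow> nat \<Rightarrow> nat set" where
  "nbhd n r X u = {v. v < n \<and> tdist (X u) (X v) < r}"

definition select_pmf :: "nat \<Rightarrow> real \<Rightarrow> (nat \<Rightarrow> real \<times> real) \<Rightarrow> (nat \<Rightarrow> nat) pmf" where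
  "select_pmf n r X = Pi_pmf {..<n} 0 (\<lambda>u. pmf_of_set (nbhd n r X u))"

definition gamma_adj :: "nat \<Rightarrow> (nat \<Rightarrow> nat) \<Rightarrow> nat \<Rightarrow> nat \<Rightarrow> bool" where
  "gamma_adj n Y u v \<longleftrightarrow> u < n \<and> v < n \<and> u \<noteq> v \<and> (Y u = v \<or> Y v = u)"

definition largest_comp :: "nat \<Rightarrow> (nat \<Rightarrow> nat \<Rightarrow> bool) \<Rightarrow> nat" where
  "largest_comp n E = Max (insert 0 ((\<lambda>u. card {v. v < n \<and> E\<^sup>*\<^sup>* u v}) ` {..<n}))"

definition unif_square :: "(real \<times> real) measure" where
  "unif_square = uniform_measure lborel ({0..1} \<times> {0..1})"

definition points_measure :: "nat \<Rightarrow> (nat \<Rightarrow> real \<times> real) measure" where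
  "points_measure n = PiM {..<n} (\<lambda>_. unif_square)"

text \<open>P(C_1(Gamma_n(r,1)) \<ge> eps n), obtained by integrating the conditional
  probability given X over the law of X.\<close>
definition prob_giant :: "nat \<Rightarrow> real \<Rightarrow> real \<Rightarrow> real" where
  "prob_giant n r eps =
     (\<integral>X. measure_pmf.prob (select_pmf n r X)
             {Y. real (largest_comp n (gamma_adj n Y)) \<ge> eps * real n}
        \<partial>points_measure n)"

end

theory Submission
  imports Defs "HOL-Real_Asymp.Real_Asymp"
begin

text \<open>
  If all balls of radius $r$ contain at most $K$ points, then following the chosen arrows from a
  vertex meets a fixed point with probability at least $1/K$ at each new vertex, so the orbit stays
  self-avoiding for $L$ steps with probability at most $(1-1/K)^L$. Taking $K$ of order
  $n r^2 + \log n$ (which bounds all ball counts with high probability, by an exponential moment)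
  and $L$ of order $K \log n$, every vertex reaches the unique cycle of its component within $L$
  steps. Hence every component has diameter of order $L r$, which tends to $0$. A component with
  $\varepsilon n$ vertices would then produce $\varepsilon^2 n^2$ pairs of points whose first
  coordinates are at torus distance of order $L r$, contradicting Markov's inequality.
\<close>

section \<open>Closeness of coordinates modulo 1\<close>

text \<open>This is closeness on the circle of reals modulo 1. With an explicit integer shift,
  triangle inequalities just add shifts and measurability is a countable union.\<close>

definition torus_close :: "real \<Rightarrow> real \<Rightarrow> real \<Rightarrow> bool" where
  "torus_close R a b \<longleftrightarrow> (\<exists>m::int. \<bar>a - b - of_int m\<bar> \<le> R)"

lemma torus_close_refl: "0 \<le> R \<Longrightarrow> torus_close R a a"
  unfolding torus_close_def by (intro exI[of _ 0]) simp

lemma torus_close_sym: "torus_close R a b \<Longrightarrow> torus_close R b a"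
  unfolding torus_close_def
proof (elim exE)
  fix m :: int assume "\<bar>a - b - of_int m\<bar> \<le> R"
  then show "\<exists>m::int. \<bar>b - a - of_int m\<bar> \<le> R" by (intro exI[of _ "-m"]) auto
qed

lemma torus_close_trans:
  assumes "torus_close R a b" "torus_close S b c" "R + S \<le> T"
  shows "torus_close T a c"
proof -
  obtain m k :: int where "\<bar>a - b - of_int m\<bar> \<le> R" "\<bar>b - c - of_int k\<bar> \<le> S"
    using assms unfolding torus_close_def by auto
  then have "\<bar>a - c - of_int (m + k)\<bar> \<le> T" using assms(3) by simp
  then show ?thesis unfolding torus_close_def by blast
qed

text \<open>The branch \<open>1 - \<bar>a - b\<bar>\<close> of the minimum corresponds to a shift by
  1 or -1, according to the sign of \<open>a - b\<close>. The outer absolute value covers points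
  outside the unit square, where that branch can be negative.\<close>

lemma torus_closeI_min:
  assumes "\<bar>min \<bar>a - b\<bar> (1 - \<bar>a - b\<bar>)\<bar> \<le> r"
  shows "torus_close r a b"
proof -
  have "\<bar>a - b - of_int 0\<bar> \<le> r \<or> \<bar>a - b - of_int 1\<bar> \<le> r \<or> \<bar>a - b - of_int (-1)\<bar> \<le> r"
    using assms by (auto simp: min_def abs_if split: if_splits)
  then show ?thesis unfolding torus_close_def by blast
qed

lemma torus_close_if_tdist_less:
  assumes "tdist x y < r"
  shows "torus_close r (fst x) (fst y)" "torus_close r (snd x) (snd y)"
proof -
  define a where "a = min \<bar>fst x - fst y\<bar> (1 - \<bar>fst x - fst y\<bar>)"
  define b where "b = min \<bar>snd x - snd y\<bar> (1 - \<bar>snd x - snd y\<bar>)"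
  have "tdist x y = sqrt (a\<^sup>2 + b\<^sup>2)" unfolding tdist_def a_def b_def ..
  then have "\<bar>a\<bar> \<le> r" "\<bar>b\<bar> \<le> r"
    using assms real_sqrt_ge_abs1[of a b] real_sqrt_ge_abs2[of b a] by linarith+
  then show "torus_close r (fst x) (fst y)" "torus_close r (snd x) (snd y)"
    unfolding a_def b_def by (auto intro: torus_closeI_min)
qed

lemma measurable_torus_close [measurable (raw)]:
  assumes [measurable]: "f \<in> borel_measurable M" "g \<in> borel_measurable M"
  shows "Measurable.pred M (\<lambda>x. torus_close R (f x) (g x))"
  unfolding torus_close_def by measurable

text \<open>At most three integer translates of an interval of length \<open>2 * R\<close> meet the
  unit interval, hence \<open>6 * R\<close>. For \<open>R \<ge> 1\<close> the bound exceeds the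
  total mass.\<close>

lemma emeasure_torus_close_le:
  assumes "0 \<le> R"
  shows "emeasure lborel ({0..1} \<inter> {b. torus_close R a b}) \<le> ennreal (6 * R)"
proof (cases "R < 1")
  case False
  have "emeasure lborel ({0..1} \<inter> {b. torus_close R a b}) \<le> emeasure lborel {0..1::real}"
    by (intro emeasure_mono) auto
  also have "\<dots> \<le> ennreal (6 * R)" using False by simp
  finally show ?thesis .
next
  case True
  \<comment> \<open>Passing to the fractional part changes \<open>a\<close> by an integer only, so
    with \<open>R < 1\<close> the only possible shifts are -1, 0 and 1.\<close>
  define c where "c = a - of_int \<lfloor>a\<rfloor>"
  have c: "0 \<le> c" "c < 1" unfolding c_def by linarith+
  define I where "I = (\<lambda>j::int. {c - of_int j - R .. c - of_int j + R})"
  have "{0..1} \<inter> {b. torus_close R a b} \<subseteq> (\<Union>j\<in>{-1..1}. I j)"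
  proof (rule subsetI)
    fix b assume b: "b \<in> {0..1} \<inter> {b. torus_close R a b}"
    then obtain m :: int where m: "\<bar>a - b - of_int m\<bar> \<le> R" unfolding torus_close_def by auto
    define j where "j = m - \<lfloor>a\<rfloor>"
    have j: "\<bar>c - b - of_int j\<bar> \<le> R" using m unfolding c_def j_def by simp
    have "of_int j < (2::real)" "of_int j > (-2::real)" using j b c True by auto
    then have "j \<in> {-1..1}" by auto
    moreover have "b \<in> I j" unfolding I_def using j by auto
    ultimately show "b \<in> (\<Union>j\<in>{-1..1}. I j)" by blast
  qed
  then have "emeasure lborel ({0..1} \<inter> {b. torus_close R a b}) \<le> emeasure lborel (\<Union>j\<in>{-1..1}. I j)"
    by (intro emeasure_mono) (auto simp: I_def)
  also have "\<dots> \<le> (\<Sum>j\<in>{-1..1}. emeasure lborel (I j))"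
    by (intro emeasure_subadditive_finite) (auto simp: I_def)
  also have "\<dots> = (\<Sum>j\<in>{-1..1::int}. ennreal (2 * R))"
    unfolding I_def using assms by (intro sum.cong) auto
  also have "\<dots> = ennreal (6 * R)"
    using assms by (subst sum_ennreal) auto
  finally show ?thesis .
qed

section \<open>The uniform distribution on the square\<close>

lemma emeasure_unit_square: "emeasure lborel ({0..1} \<times> {0..1} :: (real \<times> real) set) = 1"
proof -
  have "emeasure lborel ({0..1} \<times> {0..1} :: (real \<times> real) set)
      = emeasure lborel {0..1::real} * emeasure lborel {0..1::real}"
    by (subst lborel_prod[symmetric], rule lborel.emeasure_pair_measure_Times) auto
  then show ?thesis by simp
qed

lemma sets_unif_square [measurable_cong, simp]: "sets unif_square = sets borel"
  unfolding unif_square_def by simp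

lemma space_unif_square [simp]: "space unif_square = UNIV"
  unfolding unif_square_def by simp

lemma prob_space_unif_square: "prob_space unif_square"
  unfolding unif_square_def
  by (rule prob_space_uniform_measure) (simp_all add: emeasure_unit_square)

lemma emeasure_unif_square_Times:
  assumes [measurable]: "A \<in> sets borel" "B \<in> sets borel"
  shows "emeasure unif_square (A \<times> B)
    = emeasure lborel ({0..1} \<inter> A) * emeasure lborel ({0..1} \<inter> B)"
proof -
  have [measurable]: "A \<times> B \<in> sets borel"
    by (subst borel_prod[symmetric]) auto
  have "emeasure unif_square (A \<times> B) = emeasure lborel (({0..1} \<times> {0..1}) \<inter> (A \<times> B))"
    unfolding unif_square_def
    by (subst emeasure_uniform_measure) (auto simp: emeasure_unit_square divide_ennreal_def borel_closed closed_Times)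
  also have "({0..1} \<times> {0..1}) \<inter> (A \<times> B) = ({0..1} \<inter> A) \<times> ({0..1} \<inter> B)" by auto
  also have "emeasure lborel (\<dots> :: (real \<times> real) set)
      = emeasure lborel ({0..1} \<inter> A) * emeasure lborel ({0..1} \<inter> B)"
    by (subst lborel_prod[symmetric], rule lborel.emeasure_pair_measure_Times) auto
  finally show ?thesis .
qed

lemma emeasure_unif_square_strip_le:
  assumes "0 \<le> R"
  shows "emeasure unif_square {y. torus_close R a (fst y)} \<le> ennreal (6 * R)"
proof -
  have "{y :: real \<times> real. torus_close R a (fst y)} = {b. torus_close R a b} \<times> UNIV" by auto
  then show ?thesis
    using emeasure_torus_close_le[OF assms, of a] by (simp add: emeasure_unif_square_Times)
qed

lemma borel_measurable_fst_prod:
  fixes f :: "'a \<Rightarrow> real \<times> real"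
  assumes "f \<in> borel_measurable M"
  shows "(\<lambda>x. fst (f x)) \<in> borel_measurable M"
  using measurable_compose[OF _ measurable_fst, of f M borel borel] assms by (simp add: borel_prod)

lemma borel_measurable_tdist [measurable]:
  assumes [measurable]: "f \<in> borel_measurable M" "g \<in> borel_measurable M"
  shows "(\<lambda>x. tdist (f x) (g x)) \<in> borel_measurable M"
proof -
  have [measurable]: "f \<in> M \<rightarrow>\<^sub>M borel \<Otimes>\<^sub>M borel" "g \<in> M \<rightarrow>\<^sub>M borel \<Otimes>\<^sub>M borel"
    using assms by (simp_all add: borel_prod)
  show ?thesis unfolding tdist_def by measurable
qed

text \<open>A ball lies in the product of two strips of half-width \<open>r\<close>. The constant is
  crude, as only the order \<open>r^2\<close> matters.\<close>

lemma emeasure_unif_square_ball_le: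
  assumes "0 \<le> r"
  shows "emeasure unif_square {y. tdist x y < r} \<le> ennreal (36 * r\<^sup>2)"
proof -
  have "emeasure unif_square {y. tdist x y < r}
     \<le> emeasure unif_square ({b. torus_close r (fst x) b} \<times> {b. torus_close r (snd x) b})"
  proof (rule emeasure_mono)
    show "{b. torus_close r (fst x) b} \<times> {b. torus_close r (snd x) b} \<in> sets unif_square"
      by (simp, subst borel_prod[symmetric], intro pair_measureI) auto
  qed (auto dest: torus_close_if_tdist_less)
  also have "\<dots> \<le> ennreal (6 * r) * ennreal (6 * r)"
    by (subst emeasure_unif_square_Times) (auto intro!: mult_mono emeasure_torus_close_le assms)
  also have "\<dots> = ennreal (36 * r\<^sup>2)"
    using assms by (simp add: ennreal_mult[symmetric] power2_eq_square)
  finally show ?thesis .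
qed

section \<open>Self-avoiding orbits of a random map\<close>

text \<open>Visited vertices are deleted from $A$, so that the tail of the path depends on the
  values of $Y$ on the remaining set only; this makes it independent of the first step.\<close>
primrec self_avoiding :: "nat \<Rightarrow> 'a set \<Rightarrow> ('a \<Rightarrow> 'a) \<Rightarrow> 'a \<Rightarrow> bool" where
  "self_avoiding 0 A Y u \<longleftrightarrow> u \<in> A"
| "self_avoiding (Suc L) A Y u \<longleftrightarrow> u \<in> A \<and> self_avoiding L (A - {u}) Y (Y u)"

lemma self_avoiding_start: "self_avoiding L A Y u \<Longrightarrow> u \<in> A"
  by (cases L) auto

text \<open>A path confined to \<open>A\<close> never consults \<open>Y\<close> outside
  \<open>A\<close>. This is how the tail of the path ignores the value already revealed at the
  deleted vertex.\<close>

lemma self_avoiding_fun_upd: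
  "x \<notin> A \<Longrightarrow> self_avoiding L A (Y(x := y)) u \<longleftrightarrow> self_avoiding L A Y u"
  by (induction L arbitrary: A u) auto

lemma self_avoidingI_inj_on:
  assumes "\<And>i. i \<le> L \<Longrightarrow> (Y ^^ i) u \<in> A" "inj_on (\<lambda>i. (Y ^^ i) u) {..L}"
  shows "self_avoiding L A Y u"
  using assms
proof (induction L arbitrary: A u)
  case 0
  show ?case using "0.prems"(1)[of 0] by simp
next
  case (Suc L)
  have "self_avoiding L (A - {u}) Y (Y u)"
  proof (rule Suc.IH)
    fix i assume "i \<le> L"
    then have "(Y ^^ Suc i) u \<in> A" by (intro Suc.prems(1)) simp
    moreover have "(Y ^^ Suc i) u \<noteq> (Y ^^ 0) u"
      using Suc.prems(2) \<open>i \<le> L\<close> unfolding inj_on_def by (metis Suc_le_mono atMost_iff le0 nat.distinct(1))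
    ultimately show "(Y ^^ i) (Y u) \<in> A - {u}" by (simp add: funpow_swap1)
  next
    show "inj_on (\<lambda>i. (Y ^^ i) (Y u)) {..L}"
    proof (rule inj_onI)
      fix i j assume "i \<in> {..L}" "j \<in> {..L}" "(Y ^^ i) (Y u) = (Y ^^ j) (Y u)"
      then have "(Y ^^ Suc i) u = (Y ^^ Suc j) u" by (simp add: funpow_swap1)
      then have "Suc i = Suc j"
        using Suc.prems(2) \<open>i \<in> {..L}\<close> \<open>j \<in> {..L}\<close> by (elim inj_onD) auto
      then show "i = j" by simp
    qed
  qed
  then show ?case using Suc.prems(1)[of 0] by simp
qed

text \<open>After a repetition the orbit is periodic, so an index \<open>k \<ge> j\<close> can be
  lowered by \<open>j - i\<close> repeatedly until it falls below \<open>j\<close>.\<close>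

lemma funpow_orbit_bounded:
  fixes Y :: "'a \<Rightarrow> 'a"
  assumes "(Y ^^ i) u = (Y ^^ j) u" "i < j"
  shows "\<exists>k'<j. (Y ^^ k) u = (Y ^^ k') u"
proof (induction k rule: less_induct)
  case (less k)
  show ?case
  proof (cases "k < j")
    case False
    then have "(Y ^^ k) u = (Y ^^ (k - j)) ((Y ^^ j) u)"
      by (metis funpow_add comp_apply le_add_diff_inverse2 not_less)
    also have "\<dots> = (Y ^^ (k - j + i)) u" by (simp add: funpow_add assms(1))
    finally show ?thesis using less[of "k - j + i"] False assms(2) by auto
  qed auto
qed

text \<open>Each new vertex costs a factor \<open>q\<close>, counting only the chance that it does
  not select itself. Returns to earlier vertices would only lower the probability further.\<close>

lemma prob_self_avoiding_le:
  assumes "finite A" "0 \<le> q" "\<And>v. v \<in> A \<Longrightarrow> pmf (p v) v \<ge> 1 - q"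
  shows "measure_pmf.prob (Pi_pmf A d p) {Y. self_avoiding L A Y u} \<le> q ^ L"
  using assms
proof (induction L arbitrary: A u)
  case 0
  then show ?case by simp
next
  case (Suc L)
  show ?case
  proof (cases "u \<in> A")
    case False
    then have "{Y. self_avoiding (Suc L) A Y u} = {}" by auto
    then show ?thesis using Suc.prems(2) by (simp only: measure_empty zero_le_power)
  next
    case True
    define B where "B = A - {u}"
    have B: "finite B" "u \<notin> B" "A = insert u B" using Suc.prems True unfolding B_def by auto
    \<comment> \<open>Reveal \<open>Y u\<close> first. The remaining values form an independent
      product over \<open>B\<close>, and the tail does not see the update at
      \<open>u\<close>.\<close>
    have "emeasure (measure_pmf (Pi_pmf A d p)) {Y. self_avoiding (Suc L) A Y u}
       = (\<integral>\<^sup>+ y. emeasure (measure_pmf (Pi_pmf B d p)) {Y. self_avoiding L B Y y} \<partial>measure_pmf (p u))"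
      unfolding B(3)
      apply (subst Pi_pmf_insert'[OF B(1,2)])
      apply (subst emeasure_bind_pmf)
      apply (intro nn_integral_cong)
      apply (subst map_pmf_def[symmetric])
      apply (simp add: vimage_def self_avoiding_fun_upd B)
      done
    \<comment> \<open>Selecting \<open>u\<close> itself kills the tail because \<open>u\<close> is
      no longer in \<open>B\<close>; the indicator removes this outcome.\<close>
    also have "\<dots> \<le> (\<integral>\<^sup>+ y. ennreal (q ^ L) * indicator (- {u}) y \<partial>measure_pmf (p u))"
    proof (intro nn_integral_mono)
      fix y
      have "emeasure (measure_pmf (Pi_pmf B d p)) {Y. self_avoiding L B Y y} \<le> ennreal (q ^ L)"
        unfolding measure_pmf.emeasure_eq_measure
        by (intro ennreal_leI Suc.IH) (use Suc.prems B in auto)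
      moreover have "{Y. self_avoiding L B Y u} = {}"
        using B(2) self_avoiding_start[of L B _ u] by auto
      ultimately show "emeasure (measure_pmf (Pi_pmf B d p)) {Y. self_avoiding L B Y y}
          \<le> ennreal (q ^ L) * indicator (- {u}) y"
        by (cases "y = u") auto
    qed
    also have "\<dots> = ennreal (q ^ L * measure_pmf.prob (p u) (- {u}))"
      using Suc.prems(2) by (simp add: nn_integral_cmult measure_pmf.emeasure_eq_measure ennreal_mult)
    also have "\<dots> \<le> ennreal (q ^ Suc L)"
    proof -
      have "measure_pmf.prob (p u) (- {u}) = 1 - pmf (p u) u"
        using measure_pmf.prob_compl[of "{u}" "p u"] by (simp add: Compl_eq_Diff_UNIV measure_pmf_single)
      also have "\<dots> \<le> q" using Suc.prems(3)[OF True] by simp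
      finally show ?thesis
        using Suc.prems(2) by (intro ennreal_leI) (simp add: mult.commute[of q] mult_left_mono)
    qed
    finally show ?thesis
      using Suc.prems(2) by (simp add: measure_pmf.emeasure_eq_measure)
  qed
qed

section \<open>Deterministic geometry of components\<close>

text \<open>Every edge is an arrow of \<open>Y\<close> in one of the two directions, so appending an
  edge lengthens one of the two merging orbits by one step.\<close>

lemma gamma_adj_rtranclp_common_iterate:
  assumes "(gamma_adj n Y)\<^sup>*\<^sup>* u v"
  shows "\<exists>i j. (Y ^^ i) u = (Y ^^ j) v"
  using assms
proof (induction rule: rtranclp_induct)
  case base
  show ?case by blast
next
  case (step v w)
  then obtain i j where ij: "(Y ^^ i) u = (Y ^^ j) v" by blast
  from step(2) consider "Y v = w" | "Y w = v" unfolding gamma_adj_def by blast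
  then show ?case
  proof cases
    case 1
    have "(Y ^^ Suc i) u = (Y ^^ j) w" using ij 1 by (simp add: funpow_swap1)
    then show ?thesis by blast
  next
    case 2
    have "(Y ^^ i) u = (Y ^^ Suc j) w" using ij 2 by (simp add: funpow_swap1)
    then show ?thesis by blast
  qed
qed

text \<open>Two connected vertices share an iterate, and each is within \<open>L * r\<close> of it;
  the factor 2 comes from going there and back.\<close>

lemma component_torus_close:
  fixes x :: "nat \<Rightarrow> real"
  assumes Y: "\<And>v. v < n \<Longrightarrow> Y v < n \<and> torus_close r (x v) (x (Y v))"
    and L: "\<And>v. v < n \<Longrightarrow> \<not> self_avoiding L {..<n} Y v"
    and uv: "(gamma_adj n Y)\<^sup>*\<^sup>* u v" "u < n" "v < n" and "0 \<le> r"
  shows "torus_close (2 * real L * r) (x u) (x v)"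
proof -
  have iter: "(Y ^^ i) w < n \<and> torus_close (real i * r) (x w) (x ((Y ^^ i) w))" if "w < n" for w i
  proof (induction i)
    case (Suc i)
    then show ?case
      using Y[of "(Y ^^ i) w"] torus_close_trans[of "real i * r" "x w" "x ((Y ^^ i) w)" r]
      by (auto simp: algebra_simps)
  qed (use that torus_close_refl in auto)
  \<comment> \<open>The index \<open>k\<close> is unrestricted because nothing bounds the time at
    which two orbits merge. An orbit repeats within \<open>L\<close> steps, so every iterate already
    occurs at a time below \<open>L\<close>.\<close>
  have near: "torus_close (real L * r) (x w) (x ((Y ^^ k) w))" if w: "w < n" for w k
  proof -
    have "\<not> inj_on (\<lambda>i. (Y ^^ i) w) {..L}"
      using L[OF w] self_avoidingI_inj_on[of L Y w "{..<n}"] iter[OF w] by auto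
    then obtain i j where "i < j" "j \<le> L" "(Y ^^ i) w = (Y ^^ j) w"
      unfolding inj_on_def by (metis atMost_iff linorder_neqE_nat)
    then obtain k' where k': "k' < j" "(Y ^^ k) w = (Y ^^ k') w"
      using funpow_orbit_bounded[of i Y w j k] by auto
    then have "real k' * r \<le> real L * r"
      using \<open>j \<le> L\<close> \<open>0 \<le> r\<close> by (intro mult_right_mono) auto
    then show ?thesis
      using iter[OF w, of k'] k'(2) torus_close_refl[of 0]
        torus_close_trans[of "real k' * r" _ _ 0 _ "real L * r"] by auto
  qed
  obtain i j where "(Y ^^ i) u = (Y ^^ j) v"
    using gamma_adj_rtranclp_common_iterate[OF uv(1)] by blast
  then show ?thesis
    using near[OF uv(2), of i] near[OF uv(3), of j] 
    by (auto intro: torus_close_trans[of "real L * r" _ _ "real L * r"] torus_close_sym)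
qed

text \<open>If \<open>C\<close> is a largest component, all pairs in \<open>C \<times> C\<close> are
  close by comparison with the root \<open>u\<close>, at the price of doubling \<open>R\<close>. The
  count includes diagonal pairs.\<close>

lemma largest_comp_close_pairs:
  fixes x :: "nat \<Rightarrow> real"
  assumes close: "\<And>u v. u < n \<Longrightarrow> v < n \<Longrightarrow> E\<^sup>*\<^sup>* u v \<Longrightarrow> torus_close R (x u) (x v)"
    and large: "real (largest_comp n E) \<ge> c" "c > 0"
  shows "c\<^sup>2 \<le> real (card {(v, w). v < n \<and> w < n \<and> torus_close (2 * R) (x v) (x w)})"
proof -
  have "largest_comp n E \<in> insert 0 ((\<lambda>u. card {v. v < n \<and> E\<^sup>*\<^sup>* u v}) ` {..<n})"
    unfolding largest_comp_def by (intro Max_in) auto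
  moreover have "largest_comp n E \<noteq> 0" using large by auto
  ultimately obtain u where u: "u < n" "largest_comp n E = card {v. v < n \<and> E\<^sup>*\<^sup>* u v}"
    by auto
  define C where "C = {v. v < n \<and> E\<^sup>*\<^sup>* u v}"
  define P where "P = {(v, w). v < n \<and> w < n \<and> torus_close (2 * R) (x v) (x w)}"
  have "C \<times> C \<subseteq> P"
  proof (clarsimp simp: C_def P_def)
    fix a b assume "a < n" "E\<^sup>*\<^sup>* u a" "b < n" "E\<^sup>*\<^sup>* u b"
    then have "torus_close R (x a) (x u)" "torus_close R (x u) (x b)"
      using close[OF u(1)] torus_close_sym by blast+
    then show "torus_close (2 * R) (x a) (x b)" by (rule torus_close_trans) simp
  qed
  moreover have "finite P"
    by (rule finite_subset[of _ "{..<n} \<times> {..<n}"]) (auto simp: P_def)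
  ultimately have "card C * card C \<le> card P"
    by (metis card_mono card_cartesian_product)
  then have "real (card C) * real (card C) \<le> real (card P)"
    by (metis of_nat_le_iff of_nat_mult)
  moreover have "c\<^sup>2 \<le> (real (card C))\<^sup>2"
    using large u(2) unfolding C_def by (intro power_mono) auto
  ultimately show ?thesis unfolding P_def by (simp add: power2_eq_square)
qed

lemma self_in_nbhd: "r > 0 \<Longrightarrow> u < n \<Longrightarrow> u \<in> nbhd n r X u"
  unfolding nbhd_def tdist_def by simp

lemma finite_nbhd [simp]: "finite (nbhd n r X u)"
  unfolding nbhd_def by simp

section \<open>Conditional probability for fixed points\<close>

text \<open>If no orbit avoids itself for \<open>L\<close> steps, a large component would force more
  close pairs than \<open>pairs\<close> allows. A union bound over starting vertices does the rest.
  The radius \<open>4 * L * r\<close> is the component bound \<open>2 * L * r\<close>,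
  doubled.\<close>

lemma prob_large_component_le:
  assumes "r > 0" "K \<ge> 1" "c > 0"
    and card: "\<And>u. u < n \<Longrightarrow> real (card (nbhd n r X u)) \<le> K"
    and pairs: "real (card {(v, w). v < n \<and> w < n \<and>
        torus_close (4 * real L * r) (fst (X v)) (fst (X w))}) < c\<^sup>2"
  shows "measure_pmf.prob (select_pmf n r X) {Y. c \<le> real (largest_comp n (gamma_adj n Y))}
    \<le> real n * (1 - 1 / K) ^ L"
proof -
  define M where "M = measure_pmf (select_pmf n r X)"
  define S where "S = (\<lambda>u. {Y. self_avoiding L {..<n} Y u})"
  \<comment> \<open>The inclusion is claimed only on the support of the law, where each
    \<open>Y v\<close> lies in the ball around \<open>v\<close>.\<close>
  have "measure M {Y. c \<le> real (largest_comp n (gamma_adj n Y))} \<le> measure M (\<Union>u<n. S u)"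
    unfolding M_def
  proof (rule measure_pmf.finite_measure_mono_AE)
    have "Y \<in> (\<Union>u<n. S u)"
      if Y: "Y \<in> set_pmf (select_pmf n r X)" and large: "c \<le> real (largest_comp n (gamma_adj n Y))" for Y
    proof (rule ccontr)
      assume no: "Y \<notin> (\<Union>u<n. S u)"
      have "Y v \<in> nbhd n r X v" if "v < n" for v
      proof -
        have "nbhd n r X v \<noteq> {}" using self_in_nbhd[OF assms(1) that] by auto
        then have "set_pmf (pmf_of_set (nbhd n r X v)) = nbhd n r X v"
          by (intro set_pmf_of_set) auto
        moreover have "Y v \<in> set_pmf (pmf_of_set (nbhd n r X v))"
          using Y that by (auto simp: select_pmf_def set_Pi_pmf PiE_dflt_def)
        ultimately show ?thesis by simp
      qed
      then have step: "Y v < n \<and> torus_close r (fst (X v)) (fst (X (Y v)))" if "v < n" for v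
        using that torus_close_if_tdist_less(1) unfolding nbhd_def by blast
      have "torus_close (2 * real L * r) (fst (X u)) (fst (X v))"
        if "u < n" "v < n" "(gamma_adj n Y)\<^sup>*\<^sup>* u v" for u v
        using component_torus_close[of n Y r "\<lambda>v. fst (X v)" L u v] step no that assms(1)
        unfolding S_def by auto
      from largest_comp_close_pairs[where x = "\<lambda>v. fst (X v)", OF this large assms(3)] show False
        using pairs by (simp add: mult.assoc)
    qed
    then show "AE Y in measure_pmf (select_pmf n r X).
        Y \<in> {Y. c \<le> real (largest_comp n (gamma_adj n Y))} \<longrightarrow> Y \<in> (\<Union>u<n. S u)"
      by (intro AE_pmfI) auto
  qed simp
  also have "\<dots> \<le> (\<Sum>u<n. measure M (S u))"
    unfolding M_def by (rule measure_pmf.finite_measure_subadditive_finite) auto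
  also have "\<dots> \<le> (\<Sum>u<n. (1 - 1 / K) ^ L)"
    unfolding M_def S_def select_pmf_def
  proof (intro sum_mono prob_self_avoiding_le)
    fix v assume "v \<in> {..<n}"
    then have v: "v < n" by simp
    have ne: "nbhd n r X v \<noteq> {}" using self_in_nbhd[OF assms(1) v] by auto
    then have "real (card (nbhd n r X v)) > 0" by (simp add: card_gt_0_iff)
    \<comment> \<open>A vertex belongs to its own ball, so it selects itself with probability one
      over the ball count; this gives \<open>q = 1 - 1 / K\<close>.\<close>
    then have "1 / K \<le> 1 / real (card (nbhd n r X v))"
      using card[OF v] by (intro divide_left_mono) auto
    then show "1 - (1 - 1 / K) \<le> pmf (pmf_of_set (nbhd n r X v)) v"
      using self_in_nbhd[OF assms(1) v, of X] ne by (simp add: pmf_of_set)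
  qed (use assms(2) in auto)
  finally show ?thesis unfolding M_def by simp
qed

section \<open>Expectations over the random points\<close>

text \<open>Given the point \<open>X u\<close>, the factors are independent, so Fubini turns the
  inner integral into a product. Letting \<open>h\<close> depend on \<open>v\<close> serves both the
  pair estimate and the exponential moment.\<close>

lemma nn_integral_prod_given_coordinate_le:
  fixes h :: "'i \<Rightarrow> 'a \<times> 'a \<Rightarrow> ennreal"
  assumes "prob_space M" "finite I" "u \<notin> I"
    and h [measurable]: "\<And>v. h v \<in> borel_measurable (M \<Otimes>\<^sub>M M)"
    and bound: "\<And>v y. v \<in> I \<Longrightarrow> y \<in> space M \<Longrightarrow> (\<integral>\<^sup>+ z. h v (y, z) \<partial>M) \<le> c v"
  shows "(\<integral>\<^sup>+ X. (\<Prod>v\<in>I. h v (X u, X v)) \<partial>PiM (insert u I) (\<lambda>_. M)) \<le> (\<Prod>v\<in>I. c v)"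
proof -
  interpret prob_space M by fact
  interpret product_sigma_finite "\<lambda>_. M" by unfold_locales
  have "(\<integral>\<^sup>+ X. (\<Prod>v\<in>I. h v (X u, X v)) \<partial>PiM (insert u I) (\<lambda>_. M))
     = (\<integral>\<^sup>+ y. (\<integral>\<^sup>+ X. (\<Prod>v\<in>I. h v ((X(u := y)) u, (X(u := y)) v)) \<partial>PiM I (\<lambda>_. M)) \<partial>M)"
    by (rule product_nn_integral_insert_rev) (use assms(2,3) in measurable)
  also have "\<dots> = (\<integral>\<^sup>+ y. (\<integral>\<^sup>+ X. (\<Prod>v\<in>I. h v (y, X v)) \<partial>PiM I (\<lambda>_. M)) \<partial>M)"
    using assms(3) by (intro nn_integral_cong prod.cong) auto
  also have "\<dots> = (\<integral>\<^sup>+ y. (\<Prod>v\<in>I. (\<integral>\<^sup>+ z. h v (y, z) \<partial>M)) \<partial>M)"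
    using assms(2) by (intro nn_integral_cong product_nn_integral_prod) auto
  also have "\<dots> \<le> (\<integral>\<^sup>+ y. (\<Prod>v\<in>I. c v) \<partial>M)"
    by (intro nn_integral_mono prod_mono_ennreal bound)
  also have "\<dots> = (\<Prod>v\<in>I. c v)" by (simp add: emeasure_space_1)
  finally show ?thesis .
qed

lemma prob_space_points_measure: "prob_space (points_measure n)"
  unfolding points_measure_def by (intro prob_space_PiM prob_space_unif_square)

lemma measurable_points_measure_component [measurable]:
  "v < n \<Longrightarrow> (\<lambda>X. X v) \<in> points_measure n \<rightarrow>\<^sub>M unif_square"
  unfolding points_measure_def by measurable

lemma sets_close_pairs:
  "{(x, y). torus_close R (fst x) (fst y)} \<in> sets (unif_square \<Otimes>\<^sub>M unif_square)"
proof -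
  have "Measurable.pred (unif_square \<Otimes>\<^sub>M unif_square)
      (\<lambda>z. torus_close R (fst (fst z)) (fst (snd z)))"
    by (intro measurable_torus_close borel_measurable_fst_prod) measurable
  then show ?thesis
    by (simp add: pred_def case_prod_beta' space_pair_measure)
qed

lemma emeasure_points_measure_close_le:
  assumes "u < n" "v < n" "u \<noteq> v" "0 \<le> R"
  shows "(\<integral>\<^sup>+ X. indicator {(x, y). torus_close R (fst x) (fst y)} (X u, X v) \<partial>points_measure n)
    \<le> ennreal (6 * R)"
proof -
  define S where "S = {(x :: real \<times> real, y :: real \<times> real). torus_close R (fst x) (fst y)}"
  \<comment> \<open>A single pair becomes a product over all other points by inserting the constant
    1 at every index except \<open>v\<close>.\<close>
  define h where "h = (\<lambda>w z. if w = v then indicator S z else (1::ennreal))"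
  let ?I = "{..<n} - {u}"
  have "(\<integral>\<^sup>+ X. indicator S (X u, X v) \<partial>points_measure n)
      = (\<integral>\<^sup>+ X. (\<Prod>w\<in>?I. h w (X u, X w)) \<partial>PiM (insert u ?I) (\<lambda>_. unif_square))"
    using assms by (simp add: points_measure_def h_def insert_absorb if_distrib prod.delta)
  also have "\<dots> \<le> (\<Prod>w\<in>?I. if w = v then ennreal (6 * R) else 1)"
  proof (rule nn_integral_prod_given_coordinate_le[OF prob_space_unif_square])
    have "S \<in> sets (unif_square \<Otimes>\<^sub>M unif_square)"
      unfolding S_def by (rule sets_close_pairs)
    then show "h w \<in> borel_measurable (unif_square \<Otimes>\<^sub>M unif_square)" for w
      unfolding h_def by (cases "w = v") auto
    show "(\<integral>\<^sup>+ z. h w (y, z) \<partial>unif_square) \<le> (if w = v then ennreal (6 * R) else 1)" for w y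
    proof (cases "w = v")
      case True
      have "(\<integral>\<^sup>+ z. h w (y, z) \<partial>unif_square)
          = (\<integral>\<^sup>+ z. indicator {z. torus_close R (fst y) (fst z)} z \<partial>unif_square)"
        unfolding h_def S_def using True by (intro nn_integral_cong) (auto simp: indicator_def)
      also have "\<dots> \<le> ennreal (6 * R)"
      proof (subst nn_integral_indicator)
        show "{z. torus_close R (fst y) (fst z)} \<in> sets unif_square"
          using measurable_torus_close[OF borel_measurable_const borel_measurable_fst_prod[OF measurable_ident],
            of R "fst y"] by (simp add: pred_def)
      qed (rule emeasure_unif_square_strip_le[OF assms(4)])
      finally show ?thesis using True by simp
    qed (use prob_space.emeasure_space_1[OF prob_space_unif_square] in \<open>auto simp: h_def\<close>)
  qed auto
  also have "\<dots> = ennreal (6 * R)" using assms by (simp add: prod.delta)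
  finally show ?thesis unfolding S_def .
qed

text \<open>The product form exposes the independence of the points, and it also yields
  measurability of the exponential.\<close>

lemma exp_card_nbhd:
  "ennreal (exp (real (card (nbhd n r X u)))) = (\<Prod>v<n. if tdist (X u) (X v) < r then ennreal (exp 1) else 1)"
proof -
  have "(\<Prod>v<n. if tdist (X u) (X v) < r then ennreal (exp 1) else 1)
     = (\<Prod>v\<in>{v\<in>{..<n}. tdist (X u) (X v) < r}. ennreal (exp 1))"
    by (rule prod.inter_filter[symmetric]) simp
  also have "{v\<in>{..<n}. tdist (X u) (X v) < r} = nbhd n r X u"
    unfolding nbhd_def by auto
  finally show ?thesis
    by (simp add: ennreal_power exp_of_nat_mult[symmetric])
qed

text \<open>The point \<open>u\<close> lies in its own ball and contributes
  \<open>exp 1 \<le> 3\<close>. Each other point contributes at most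
  \<open>1 + 2 * 36 * r^2\<close>, hence at most \<open>exp (72 * r^2)\<close>.\<close>

lemma nn_integral_exp_card_nbhd_le:
  assumes "u < n" "r > 0"
  shows "(\<integral>\<^sup>+ X. ennreal (exp (real (card (nbhd n r X u)))) \<partial>points_measure n)
    \<le> ennreal (3 * exp (72 * real n * r\<^sup>2))"
proof -
  let ?I = "{..<n} - {u}"
  interpret U: prob_space unif_square by (rule prob_space_unif_square)
  define h where "h = (\<lambda>(x, y). if tdist x y < r then ennreal (exp 1) else 1)"
  have [measurable]: "h \<in> borel_measurable (unif_square \<Otimes>\<^sub>M unif_square)"
    unfolding h_def by measurable
  have *: "ennreal (exp (real (card (nbhd n r X u)))) = ennreal (exp 1) * (\<Prod>v\<in>?I. h (X u, X v))" for X
    unfolding exp_card_nbhd h_def using assms by (subst prod.remove[of _ u]) (auto simp: tdist_def)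
  have "(\<integral>\<^sup>+ X. ennreal (exp (real (card (nbhd n r X u)))) \<partial>points_measure n)
     = ennreal (exp 1) * (\<integral>\<^sup>+ X. (\<Prod>v\<in>?I. h (X u, X v)) \<partial>points_measure n)"
    unfolding * using assms by (intro nn_integral_cmult) measurable
  also have "(\<integral>\<^sup>+ X. (\<Prod>v\<in>?I. h (X u, X v)) \<partial>points_measure n)
     = (\<integral>\<^sup>+ X. (\<Prod>v\<in>?I. h (X u, X v)) \<partial>PiM (insert u ?I) (\<lambda>_. unif_square))"
    using assms by (simp add: points_measure_def insert_absorb)
  also have "\<dots> \<le> (\<Prod>v\<in>?I. ennreal (exp (72 * r\<^sup>2)))"
  proof (rule nn_integral_prod_given_coordinate_le[OF prob_space_unif_square])
    fix y :: "real \<times> real"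
    have "(\<integral>\<^sup>+ z. h (y, z) \<partial>unif_square)
        \<le> (\<integral>\<^sup>+ z. 1 + 2 * indicator {z. tdist y z < r} z \<partial>unif_square)"
    proof (intro nn_integral_mono)
      fix z
      have "ennreal (exp 1) \<le> ennreal 3" using exp_le by (rule ennreal_leI)
      then show "h (y, z) \<le> 1 + 2 * indicator {z. tdist y z < r} z"
        unfolding h_def by (auto simp: indicator_def)
    qed
    also have "\<dots> = 1 + 2 * emeasure unif_square {z. tdist y z < r}"
      by (subst nn_integral_add) (use U.emeasure_space_1 in \<open>auto simp: nn_integral_cmult\<close>)
    also have "\<dots> \<le> 1 + 2 * ennreal (36 * r\<^sup>2)"
      using emeasure_unif_square_ball_le[of r y] assms by (intro add_left_mono mult_left_mono) auto
    also have "\<dots> = ennreal (1 + 72 * r\<^sup>2)"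
      by (simp add: ennreal_mult flip: ennreal_numeral ennreal_1 ennreal_plus ennreal_mult)
    also have "\<dots> \<le> ennreal (exp (72 * r\<^sup>2))"
      by (intro ennreal_leI exp_ge_add_one_self)
    finally show "(\<integral>\<^sup>+ z. h (y, z) \<partial>unif_square) \<le> ennreal (exp (72 * r\<^sup>2))" .
  qed auto
  also have "\<dots> = ennreal (exp (72 * real (n - 1) * r\<^sup>2))"
    using assms by (simp add: ennreal_power exp_of_nat_mult[symmetric] mult_ac)
  also have "ennreal (exp 1) * \<dots> \<le> ennreal 3 * ennreal (exp (72 * real n * r\<^sup>2))"
    using exp_le by (intro mult_mono ennreal_leI) (auto intro!: mult_right_mono)
  finally show ?thesis by (simp add: ennreal_mult mult_left_mono)
qed

section \<open>A bound for fixed \<open>n\<close> with free parameters \<open>K\<close> and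
  \<open>L\<close>\<close>

text \<open>The three terms account for an overfull ball, for too many close pairs, and for a long
  self-avoiding orbit when neither occurs. In the second, 24 is 6 times 4 and
  \<open>1 / real n\<close> comes from the diagonal pairs.\<close>

lemma prob_giant_le:
  assumes "n > 0" "r > 0" "eps > 0" "K \<ge> 1"
  shows "prob_giant n r eps \<le> 3 * real n * exp (72 * real n * r\<^sup>2 - K)
    + (24 * real L * r + 1 / real n) / eps\<^sup>2 + real n * (1 - 1 / K) ^ L"
    (is "_ \<le> ?a + ?b + ?d")
proof -
  interpret prob_space "points_measure n" by (rule prob_space_points_measure)
  define f where "f = (\<lambda>X. measure_pmf.prob (select_pmf n r X)
      {Y. eps * real n \<le> real (largest_comp n (gamma_adj n Y))})"
  define R where "R = 4 * real L * r"
  define c where "c = (eps * real n)\<^sup>2"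
  have c: "c > 0" unfolding c_def using assms by simp
  have R: "R \<ge> 0" unfolding R_def using assms by simp
  define S where "S = {(x :: real \<times> real, y :: real \<times> real). torus_close R (fst x) (fst y)}"
  define g1 where "g1 = (\<lambda>X. \<Sum>u<n. ennreal (exp (-K)) * ennreal (exp (real (card (nbhd n r X u)))))"
  define g2 where "g2 = (\<lambda>X. \<Sum>u<n. \<Sum>v<n. ennreal (1 / c) * indicator S (X u, X v))"
  have S_sets [measurable]: "S \<in> sets (unif_square \<Otimes>\<^sub>M unif_square)"
    unfolding S_def by (rule sets_close_pairs)
  have d: "?d \<ge> 0" using assms by simp
  \<comment> \<open>A pointwise bound by a measurable function: the integrand $f$ itself is never shown to be measurable.\<close>
  have fg: "ennreal (f X) \<le> g1 X + g2 X + ennreal ?d" for X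
  proof -
    have f1: "f X \<le> 1" unfolding f_def by simp
    let ?P = "{(v, w). v < n \<and> w < n \<and> torus_close R (fst (X v)) (fst (X w))}"
    consider u where "u < n" "K < real (card (nbhd n r X u))"
      | "c \<le> real (card ?P)"
      | "\<And>u. u < n \<Longrightarrow> real (card (nbhd n r X u)) \<le> K" "real (card ?P) < c"
      by (meson not_le)
    then show ?thesis
    proof cases
      case 1
      \<comment> \<open>Exponential Markov bound: the right-hand side exceeds 1, which bounds
        \<open>f X\<close>.\<close>
      have "ennreal (f X) \<le> ennreal (exp (-K) * exp (real (card (nbhd n r X u))))"
        using f1 1 by (intro ennreal_leI order_trans[OF f1]) (simp flip: exp_add)
      also have "\<dots> = ennreal (exp (-K)) * ennreal (exp (real (card (nbhd n r X u))))"
        by (rule ennreal_mult) auto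
      also have "\<dots> \<le> g1 X"
        unfolding g1_def using 1
        by (intro member_le_sum[of u "{..<n}" "\<lambda>u. ennreal (exp (-K)) * ennreal (exp (real (card (nbhd n r X u))))"]) auto
      finally show ?thesis by (simp add: add.assoc add_increasing2)
    next
      case 2
      have "g2 X = (\<Sum>p\<in>{..<n} \<times> {..<n}. ennreal (1 / c) * indicator S (X (fst p), X (snd p)))"
        unfolding g2_def by (simp only: sum.cartesian_product case_prod_beta')
      also have "\<dots> = (\<Sum>p\<in>?P. ennreal (1 / c))"
        by (rule sum.mono_neutral_cong_right) (auto simp: S_def indicator_def)
      also have "\<dots> = ennreal (real (card ?P) / c)"
        using c by (simp add: ennreal_of_nat_eq_real_of_nat flip: ennreal_mult)
      \<comment> \<open>Markov's inequality for the pair count: \<open>g2 X\<close> is this count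
        divided by \<open>c\<close>.\<close>
      finally have "g2 X \<ge> ennreal 1"
        using 2 c by (auto intro!: ennreal_leI)
      then have "ennreal (f X) \<le> g2 X" using f1 by (metis ennreal_leI order_trans)
      then show ?thesis by (simp add: add.assoc add_increasing add_increasing2)
    next
      case 3
      have "f X \<le> ?d" unfolding f_def
        using 3 assms unfolding R_def c_def by (intro prob_large_component_le) auto
      then show ?thesis by (intro add_increasing ennreal_leI) auto
    qed
  qed
  have exp_card_meas [measurable]: "(\<lambda>X. ennreal (exp (real (card (nbhd n r X u))))) \<in> borel_measurable (points_measure n)"
    if "u < n" for u
  proof -
    have "(\<lambda>X. X v) \<in> borel_measurable (points_measure n)" if "v < n" for v
      using measurable_points_measure_component[OF that]
      unfolding measurable_cong_sets[OF refl sets_unif_square] .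
    then have "(\<lambda>X. tdist (X u) (X v)) \<in> borel_measurable (points_measure n)" if "v < n" for v
      using \<open>u < n\<close> that by (intro borel_measurable_tdist) auto
    then have "Measurable.pred (points_measure n) (\<lambda>X. tdist (X u) (X v) < r)" if "v < n" for v
      using that by (intro borel_measurable_pred_less) auto
    then show ?thesis
      unfolding exp_card_nbhd by (intro borel_measurable_prod_ennreal measurable_If) (auto simp: pred_def)
  qed
  have [measurable]: "g1 \<in> borel_measurable (points_measure n)" "g2 \<in> borel_measurable (points_measure n)"
    unfolding g1_def g2_def by measurable
  have "(\<integral>\<^sup>+ X. g1 X \<partial>points_measure n)
      = (\<Sum>u<n. ennreal (exp (-K)) * (\<integral>\<^sup>+ X. ennreal (exp (real (card (nbhd n r X u)))) \<partial>points_measure n))"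
    unfolding g1_def
    by (subst nn_integral_sum)
       (auto intro!: sum.cong nn_integral_cmult exp_card_meas borel_measurable_times_ennreal simp del: borel_measurable_ennreal_iff)
  also have "\<dots> \<le> (\<Sum>u<n. ennreal (exp (-K)) * ennreal (3 * exp (72 * real n * r\<^sup>2)))"
    using assms by (intro sum_mono mult_left_mono nn_integral_exp_card_nbhd_le) auto
  also have "\<dots> = ennreal ?a"
    by (simp add: ennreal_of_nat_eq_real_of_nat exp_diff exp_minus field_simps flip: ennreal_mult)
  finally have I1: "(\<integral>\<^sup>+ X. g1 X \<partial>points_measure n) \<le> ennreal ?a" .
  have I2uv: "(\<integral>\<^sup>+ X. indicator S (X u, X v) \<partial>points_measure n) \<le> ennreal (6 * R + of_bool (u = v))"
    if "u < n" "v < n" for u v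
  proof (cases "u = v")
    case True
    have "(\<integral>\<^sup>+ X. indicator S (X u, X v) \<partial>points_measure n) \<le> (\<integral>\<^sup>+ X. 1 \<partial>points_measure n)"
      by (intro nn_integral_mono) (auto simp: indicator_def)
    also have "\<dots> = ennreal 1" by (simp add: emeasure_space_1)
    also have "\<dots> \<le> ennreal (6 * R + of_bool (u = v))" using True R by (intro ennreal_leI) simp
    finally show ?thesis .
  next
    case False
    then show ?thesis
      using emeasure_points_measure_close_le[OF that False R] unfolding S_def by simp
  qed
  have "(\<integral>\<^sup>+ X. g2 X \<partial>points_measure n)
      = (\<Sum>u<n. \<Sum>v<n. ennreal (1 / c) * (\<integral>\<^sup>+ X. indicator S (X u, X v) \<partial>points_measure n))"
  proof -
    have meas: "(\<lambda>X. indicator S (X u, X v) :: ennreal) \<in> borel_measurable (points_measure n)"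
      if "u < n" "v < n" for u v
      using that by measurable
    have "(\<integral>\<^sup>+ X. g2 X \<partial>points_measure n)
        = (\<Sum>u<n. \<integral>\<^sup>+ X. (\<Sum>v<n. ennreal (1 / c) * indicator S (X u, X v)) \<partial>points_measure n)"
      unfolding g2_def
      by (intro nn_integral_sum borel_measurable_sum borel_measurable_times_ennreal
        borel_measurable_const meas) auto
    also have "\<dots> = (\<Sum>u<n. \<Sum>v<n. \<integral>\<^sup>+ X. ennreal (1 / c) * indicator S (X u, X v) \<partial>points_measure n)"
      by (intro sum.cong refl nn_integral_sum borel_measurable_times_ennreal
        borel_measurable_const meas) auto
    also have "\<dots> = (\<Sum>u<n. \<Sum>v<n. ennreal (1 / c) * (\<integral>\<^sup>+ X. indicator S (X u, X v) \<partial>points_measure n))"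
      by (intro sum.cong refl nn_integral_cmult meas) auto
    finally show ?thesis .
  qed
  also have "\<dots> \<le> (\<Sum>u<n. \<Sum>v<n. ennreal (1 / c) * ennreal (6 * R + of_bool (u = v)))"
    by (intro sum_mono mult_left_mono I2uv) auto
  also have "\<dots> = (\<Sum>u<n. \<Sum>v<n. ennreal (1 / c * (6 * R + of_bool (u = v))))"
    using c R by (intro sum.cong ennreal_mult[symmetric]) auto
  also have "\<dots> = ennreal (\<Sum>u<n. \<Sum>v<n. 1 / c * (6 * R + of_bool (u = v)))"
    using c R by (subst sum_ennreal, simp)+ (auto intro!: sum_nonneg)
  also have "(\<Sum>u<n. \<Sum>v<n. 1 / c * (6 * R + of_bool (u = v))) = ?b"
  proof -
    have "(\<Sum>u<n. \<Sum>v<n. 1 / c * (6 * R + of_bool (u = v)))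
        = 1 / c * (\<Sum>u<n. (\<Sum>v<n. 6 * R) + (\<Sum>v<n. if u = v then 1 else 0))"
      by (simp only: sum_distrib_left[symmetric] sum.distrib of_bool_def)
    also have "\<dots> = 1 / c * (real n * real n * (6 * R) + real n)"
      by (simp add: sum.distrib algebra_simps)
    also have "\<dots> = ?b"
      unfolding c_def R_def using assms by (simp add: field_simps power2_eq_square)
    finally show ?thesis .
  qed
  finally have I2: "(\<integral>\<^sup>+ X. g2 X \<partial>points_measure n) \<le> ennreal ?b" .
  have "(\<integral>\<^sup>+ X. ennreal (f X) \<partial>points_measure n)
      \<le> (\<integral>\<^sup>+ X. g1 X + g2 X + ennreal ?d \<partial>points_measure n)"
    by (intro nn_integral_mono fg)
  also have "\<dots> = (\<integral>\<^sup>+ X. g1 X \<partial>points_measure n) + (\<integral>\<^sup>+ X. g2 X \<partial>points_measure n) + ennreal ?d"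
    by (simp add: nn_integral_add emeasure_space_1)
  also have "\<dots> \<le> ennreal ?a + ennreal ?b + ennreal ?d"
    by (intro add_mono I1 I2 order_refl)
  also have "\<dots> = ennreal (?a + ?b + ?d)"
    using assms d by (simp flip: ennreal_plus)
  finally have "(\<integral>\<^sup>+ X. ennreal (f X) \<partial>points_measure n) \<le> ennreal (?a + ?b + ?d)" .
  \<comment> \<open>A non-integrable function has Bochner integral 0 by convention, so the bound
    covers that case too.\<close>
  then have "(\<integral>X. f X \<partial>points_measure n) \<le> ?a + ?b + ?d"
    using assms d by (intro integral_real_bounded) auto
  then show ?thesis unfolding prob_giant_def f_def .
qed

section \<open>Choice of parameters and the limit\<close>

theorem theorem2:
  fixes r :: "nat \<Rightarrow> real" and eps :: real
  assumes "\<And>n. r n > 0"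
    and "r \<in> o(\<lambda>n. (real n * ln (real n)) powr (-1/3))"
    and "eps > 0"
  shows "(\<lambda>n. prob_giant n (r n) eps) \<longlonglongrightarrow> 0"
proof -
  define b where "b = (\<lambda>n. (real n * ln (real n)) powr (-1/3))"
  define a where "a = (\<lambda>n. r n / b n)"
  have a0: "a \<longlonglongrightarrow> 0"
    using smalloD_tendsto[OF assms(2)] unfolding a_def b_def .
  have b_pos: "b n > 0" if "n \<ge> 2" for n
    using that unfolding b_def by simp
  have r_eq: "r n = a n * b n" if "n \<ge> 2" for n
    using b_pos[OF that] unfolding a_def by simp
  have b_cube: "real n * ln (real n) * b n ^ 3 = 1" if "n \<ge> 2" for n
  proof -
    have pos: "real n * ln (real n) > 0" using that by simp
    have "b n ^ 3 = (real n * ln (real n)) powr (-1)"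
      unfolding b_def using powr_realpow[of "(real n * ln (real n)) powr (-1/3)" 3] pos
      by (fastforce simp: powr_powr)
    also have "\<dots> = inverse (real n * ln (real n))"
      using pos by (subst powr_minus) simp
    finally show ?thesis using pos by (metis right_inverse less_irrefl)
  qed
  \<comment> \<open>The first term cancels the exponential moment, \<open>2 * ln (real n)\<close>
    leaves a factor \<open>1 / n^2\<close> against the prefactor \<open>3 * n\<close>, and the final
    1 ensures \<open>K n \<ge> 1\<close>.\<close>
  define K where "K = (\<lambda>n. 72 * real n * (r n)\<^sup>2 + 2 * ln (real n) + 1)"
  \<comment> \<open>With this length \<open>(1 - 1 / K)^L \<le> exp (- L / K) \<le> 1 / n^2\<close>,
    which beats the union bound over \<open>n\<close> vertices.\<close>
  define L where "L = (\<lambda>n. nat \<lceil>2 * K n * ln (real n)\<rceil>)"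
  \<comment> \<open>An upper bound for \<open>L n * r n\<close>. Its leading part is
    \<open>144 * n * ln n * r^3\<close>, which equals \<open>144 * a^3\<close>: this is where the
    exponent -1/3 enters. The last \<open>b n\<close> pays for the ceiling in
    \<open>L\<close>.\<close>
  define e where "e = (\<lambda>n. 144 * a n ^ 3 + a n * (4 * ln (real n) ^ 2 * b n + 2 * ln (real n) * b n + b n))"
  define B where "B = (\<lambda>n. 3 / real n + (24 * e n + 1 / real n) / eps\<^sup>2 + 1 / real n)"
  have "(\<lambda>n. 4 * ln (real n) ^ 2 * b n + 2 * ln (real n) * b n + b n) \<longlonglongrightarrow> 0"
    unfolding b_def by real_asymp
  then have "e \<longlonglongrightarrow> 144 * 0 ^ 3 + 0 * 0"
    unfolding e_def by (intro tendsto_intros a0)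
  then have e0: "e \<longlonglongrightarrow> 0" by simp
  have "B \<longlonglongrightarrow> 0 + (24 * 0 + 0) / eps\<^sup>2 + 0"
    unfolding B_def using assms(3) by (intro tendsto_intros e0 lim_const_over_n) auto
  then have B0: "B \<longlonglongrightarrow> 0" by simp
  have "prob_giant n (r n) eps \<le> B n" if n: "n \<ge> 2" for n
  proof -
    have ln_pos: "ln (real n) > 0" using n by simp
    have E: "exp (- ln (real n) - ln (real n)) = inverse (real n) / real n"
      unfolding exp_diff exp_minus using n by simp
    have K1: "K n \<ge> 1" unfolding K_def using ln_pos by simp
    have L_ge: "2 * K n * ln (real n) \<le> real (L n)" unfolding L_def by linarith
    have "0 \<le> 2 * K n * ln (real n)" using K1 ln_pos by simp
    then have L_le: "real (L n) \<le> 2 * K n * ln (real n) + 1" unfolding L_def by linarith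
    have "real (L n) * r n \<le> (2 * K n * ln (real n) + 1) * r n"
      using L_le assms(1)[of n] by (intro mult_right_mono) auto
    also have "\<dots> = 144 * (real n * ln (real n) * r n ^ 3)
        + (4 * ln (real n) ^ 2 * r n + 2 * ln (real n) * r n + r n)"
      unfolding K_def by (simp add: algebra_simps power2_eq_square power3_eq_cube)
    also have "real n * ln (real n) * r n ^ 3 = a n ^ 3 * (real n * ln (real n) * b n ^ 3)"
      unfolding r_eq[OF n] by (simp add: power_mult_distrib)
    also have "\<dots> = a n ^ 3" using b_cube[OF n] by simp
    also have "144 * a n ^ 3 + (4 * ln (real n) ^ 2 * r n + 2 * ln (real n) * r n + r n) = e n"
      unfolding e_def r_eq[OF n] by (simp add: algebra_simps)
    finally have Lr: "real (L n) * r n \<le> e n" .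
    have "3 * real n * exp (72 * real n * (r n)\<^sup>2 - K n) \<le> 3 * real n * exp (- ln (real n) - ln (real n))"
      unfolding K_def by (intro mult_left_mono) auto
    also have "\<dots> = 3 / real n"
      unfolding E using n by (simp add: field_simps)
    finally have 1: "3 * real n * exp (72 * real n * (r n)\<^sup>2 - K n) \<le> 3 / real n" .
    \<comment> \<open>This uses \<open>1 + x \<le> exp x\<close> at \<open>x = - 1 / K n\<close>;
      \<open>K n \<ge> 1\<close> keeps the base nonnegative.\<close>
    have "(1 - 1 / K n) ^ L n \<le> exp (- 1 / K n) ^ L n"
      using K1 exp_ge_add_one_self[of "- 1 / K n"] by (intro power_mono) auto
    also have "\<dots> = exp (- (real (L n) / K n))" by (simp add: exp_of_nat_mult[symmetric])
    also have "\<dots> \<le> exp (- ln (real n) - ln (real n))"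
      using L_ge K1 by (simp add: field_simps)
    finally have "real n * (1 - 1 / K n) ^ L n \<le> real n * exp (- ln (real n) - ln (real n))"
      by (intro mult_left_mono) auto
    also have "\<dots> = 1 / real n" unfolding E using n by (simp add: field_simps)
    finally have 3: "real n * (1 - 1 / K n) ^ L n \<le> 1 / real n" .
    have "(24 * real (L n) * r n + 1 / real n) / eps\<^sup>2 \<le> (24 * e n + 1 / real n) / eps\<^sup>2"
      using Lr by (intro divide_right_mono) auto
    with 1 3 prob_giant_le[of n "r n" eps "K n" "L n"] show ?thesis
      unfolding B_def using n assms K1 by simp
  qed
  then have "eventually (\<lambda>n. prob_giant n (r n) eps \<le> B n) sequentially"
    by (rule eventually_sequentiallyI)
  moreover have "prob_giant n (r n) eps \<ge> 0" for n
    unfolding prob_giant_def by (intro integral_nonneg_AE) auto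
  ultimately show ?thesis
    by (intro tendsto_sandwich[OF _ _ tendsto_const B0]) auto
qed

end
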